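(* Let $F_1,\dots,F_N$ and $G_1,\dots,G_N$ be holomorphic functions on $\mathbb{D}$, and write $\hat h(z):=\overline{h(\overline z)}$. Define the $2\times2N$ matrix $$\mathsf{F}(z)=\begin{pmatrix}F_1(z)&-G_1(z)&\cdots&F_N(z)&-G_N(z)\\ \hat G_1(z)&\hat F_1(z)&\cdots&\hat G_N(z)&\hat F_N(z)\end{pmatrix}$$ and let $\mathcal{M}(z)=\mathsf{F}(z)\mathsf{F}^*(z)$ be the associated $2\times2$ matrix. Then $$\begin{aligned}\det\mathcal{M}(z)&=\sum_{r=1}^N\sum_{j=1}^N\bigl|F_j(z)\hat F_r(z)+G_r(z)\hat G_j(z)\bigr|^2\\&\quad+\sum_{1\le r<j\le N}\bigl|F_j(z)\hat G_r(z)-F_r(z)\hat G_j(z)\bigr|^2\\&\quad+\sum_{1\le r<j\le N}\bigl|G_j(z)\hat F_r(z)-G_r(z)\hat F_j(z)\bigr|^2.\end{aligned}$$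
   Context: $\mathbb{D}$ is the open unit disc in $\mathbb{C}$, $N$ is a positive integer, and $\mathsf{F}^*$ denotes the conjugate transpose. *)

theory Defs
  imports
    "HOL-Analysis.Complex_Analysis_Basics"
    "Jordan_Normal_Form.Schur_Decomposition"
begin

definition hat :: "(complex \<Rightarrow> complex) \<Rightarrow> complex \<Rightarrow> complex" where
  "hat h z = cnj (h (cnj z))"

(* Matrix indices start at 0, whereas the functions are numbered 1, ..., N: the two columns
   belonging to F_j and G_j are those with k = 2 * (j - 1) and k = 2 * (j - 1) + 1. *)
definition F_matrix ::
  "nat \<Rightarrow> (nat \<Rightarrow> complex \<Rightarrow> complex) \<Rightarrow> (nat \<Rightarrow> complex \<Rightarrow> complex) \<Rightarrow> complex \<Rightarrow> complex Matrix.mat"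
where
  "F_matrix N F G z = Matrix.mat 2 (2 * N) (\<lambda>(i, k).
     let j = k div 2 + 1 in
       if i = 0 then (if even k then F j z else - G j z)
       else (if even k then hat (G j) z else hat (F j) z))"

definition M_matrix ::
  "nat \<Rightarrow> (nat \<Rightarrow> complex \<Rightarrow> complex) \<Rightarrow> (nat \<Rightarrow> complex \<Rightarrow> complex) \<Rightarrow> complex \<Rightarrow> complex Matrix.mat"
where
  "M_matrix N F G z = F_matrix N F G z * mat_adjoint (F_matrix N F G z)"

end

theory Submission
  imports Defs
begin

text \<open>The claim is the Cauchy-Binet formula for the Gram determinant of the two rows of the matrix.
  A pair of columns consisting of a column of \<open>F\<^sub>j\<close> and one of \<open>G\<^sub>r\<close> gives a term of the full double
  sum, and the pairs of columns of the same type give the two triangular sums. Lagrange's identity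
  evaluates the latter; the inner product of the two rows is a difference \<open>P - Q\<close>, and the mixed
  terms of \<open>\<bar>P - Q\<bar>\<^sup>2\<close> come from the double sum.\<close>

text \<open>Sorting the pairs by their larger component makes the triangular sums accessible to
  induction on \<open>N\<close>.\<close>

lemma sum_strict_pairs_Suc:
  fixes f :: "nat \<Rightarrow> nat \<Rightarrow> 'a::comm_monoid_add"
  shows "(\<Sum>(r, j)\<in>{(r, j). 1 \<le> r \<and> r < j \<and> j \<le> Suc N}. f r j) =
    (\<Sum>(r, j)\<in>{(r, j). 1 \<le> r \<and> r < j \<and> j \<le> N}. f r j) + (\<Sum>r\<in>{1..N}. f r (Suc N))"
proof -
  let ?S = "{(r, j). 1 \<le> r \<and> r < j \<and> j \<le> N}" and ?T = "(\<lambda>r. (r, Suc N)) ` {1..N}"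
  have eq: "{(r, j). 1 \<le> r \<and> r < j \<and> j \<le> Suc N} = ?S \<union> ?T"
    by auto
  have fin: "finite ?S"
    by (rule finite_subset[of _ "{1..N} \<times> {1..N}"]) auto
  have disj: "?S \<inter> ?T = {}"
    by auto
  show ?thesis
    unfolding eq sum.union_disjoint[OF fin finite_imageI[OF finite_atLeastAtMost] disj]
    by (simp add: sum.reindex inj_on_def)
qed

text \<open>The right-hand side is the Gram determinant of the vectors \<open>x\<close> and
  \<open>y\<close>. When \<open>N\<close> grows by one, both sides grow by the same mixed terms, so
  induction applies.\<close>

lemma Lagrange_identity_cmod:
  fixes x y :: "nat \<Rightarrow> complex"
  shows "complex_of_real (\<Sum>(r, j)\<in>{(r, j). 1 \<le> r \<and> r < j \<and> j \<le> N}.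
        (cmod (x j * y r - x r * y j))\<^sup>2) =
    (\<Sum>j\<in>{1..N}. x j * cnj (x j)) * (\<Sum>j\<in>{1..N}. y j * cnj (y j)) -
    (\<Sum>j\<in>{1..N}. x j * cnj (y j)) * (\<Sum>j\<in>{1..N}. y j * cnj (x j))"
proof (induction N)
  case 0
  have "{(r, j). 1 \<le> r \<and> r < j \<and> j \<le> (0::nat)} = {}" by auto
  then show ?case by (simp only: sum.empty) simp
next
  case (Suc N)
  \<comment> \<open>These four terms are the mixed terms that arise when the sums up to
    \<open>Suc N\<close> are multiplied out; the two products of last summands alone cancel.\<close>
  have "complex_of_real (\<Sum>r\<in>{1..N}. (cmod (x (Suc N) * y r - x r * y (Suc N)))\<^sup>2) =
    x (Suc N) * cnj (x (Suc N)) * (\<Sum>r\<in>{1..N}. y r * cnj (y r))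
    - x (Suc N) * cnj (y (Suc N)) * (\<Sum>r\<in>{1..N}. y r * cnj (x r))
    - y (Suc N) * cnj (x (Suc N)) * (\<Sum>r\<in>{1..N}. x r * cnj (y r))
    + y (Suc N) * cnj (y (Suc N)) * (\<Sum>r\<in>{1..N}. x r * cnj (x r))"
    unfolding of_real_sum complex_norm_square
      sum_distrib_left sum_subtractf[symmetric] sum.distrib[symmetric]
    by (rule sum.cong) (simp_all add: algebra_simps)
  moreover have "(\<Sum>j\<in>{1..Suc N}. f j) = (\<Sum>j\<in>{1..N}. f j) + f (Suc N)" for f :: "nat \<Rightarrow> complex"
    by simp
  ultimately show ?case
    by (simp only: sum_strict_pairs_Suc of_real_add Suc.IH) (simp only: algebra_simps)
qed

text \<open>Each squared modulus expands into four terms, each a function of \<open>j\<close> times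
  a function of \<open>r\<close>, so the double sum over the full square factorizes.\<close>

lemma sum_cross_pairs_cmod:
  fixes a b c d :: "nat \<Rightarrow> complex"
  shows "complex_of_real (\<Sum>r\<in>A. \<Sum>j\<in>A. (cmod (a j * d r + b r * c j))\<^sup>2) =
    (\<Sum>j\<in>A. a j * cnj (a j)) * (\<Sum>r\<in>A. d r * cnj (d r)) +
    (\<Sum>j\<in>A. a j * cnj (c j)) * (\<Sum>r\<in>A. d r * cnj (b r)) +
    (\<Sum>j\<in>A. c j * cnj (a j)) * (\<Sum>r\<in>A. b r * cnj (d r)) +
    (\<Sum>j\<in>A. c j * cnj (c j)) * (\<Sum>r\<in>A. b r * cnj (b r))"
proof -
  have "(\<Sum>j\<in>A. (a j * d r + b r * c j) * cnj (a j * d r + b r * c j)) =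
    (\<Sum>j\<in>A. a j * cnj (a j)) * (d r * cnj (d r)) +
    (\<Sum>j\<in>A. a j * cnj (c j)) * (d r * cnj (b r)) +
    (\<Sum>j\<in>A. c j * cnj (a j)) * (b r * cnj (d r)) +
    (\<Sum>j\<in>A. c j * cnj (c j)) * (b r * cnj (b r))" for r
    unfolding sum_distrib_right sum.distrib[symmetric]
    by (rule sum.cong) (simp_all add: algebra_simps)
  then show ?thesis
    unfolding of_real_sum complex_norm_square by (simp only: sum.distrib sum_distrib_left)
qed

text \<open>Turns a sum over the columns of \<open>F_matrix\<close> into a sum over the function
  index \<open>j\<close>, which owns two adjacent columns.\<close>

lemma sum_consecutive_pairs:
  fixes f :: "nat \<Rightarrow> 'a::comm_monoid_add"
  shows "(\<Sum>k\<in>{0..<2 * N}. f k) = (\<Sum>j\<in>{1..N}. f (2 * (j - 1)) + f (2 * (j - 1) + 1))"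
  by (induction N) (simp_all add: ac_simps)

lemma det_mat_2:
  fixes A :: "'a::comm_ring_1 Matrix.mat"
  assumes "A \<in> carrier_mat 2 2"
  shows "Determinant.det A = A $$ (0, 0) * A $$ (1, 1) - A $$ (0, 1) * A $$ (1, 0)"
  using assms
  by (subst laplace_expansion_row[of _ _ 0])
    (auto simp: cofactor_def mat_delete_def det_single numeral_2_eq_2)

lemma F_matrix_index:
  assumes "j \<in> {1..N}"
  shows "F_matrix N F G z $$ (0, 2 * (j - 1)) = F j z"
    and "F_matrix N F G z $$ (0, 2 * (j - 1) + 1) = - G j z"
    and "F_matrix N F G z $$ (1, 2 * (j - 1)) = hat (G j) z"
    and "F_matrix N F G z $$ (1, 2 * (j - 1) + 1) = hat (F j) z"
proof -
  \<comment> \<open>With \<open>j = Suc i\<close> the truncated \<open>j - 1\<close> becomes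
    \<open>i\<close>; halving \<open>2 * i\<close> or \<open>2 * i + 1\<close> gives
    \<open>i\<close> back, and \<open>i < N\<close> keeps both columns in range.\<close>
  from assms obtain i where "j = Suc i" "i < N"
    by (cases j) auto
  then show "F_matrix N F G z $$ (0, 2 * (j - 1)) = F j z"
    and "F_matrix N F G z $$ (0, 2 * (j - 1) + 1) = - G j z"
    and "F_matrix N F G z $$ (1, 2 * (j - 1)) = hat (G j) z"
    and "F_matrix N F G z $$ (1, 2 * (j - 1) + 1) = hat (F j) z"
    by (simp_all add: F_matrix_def)
qed

lemma F_matrix_carrier: "F_matrix N F G z \<in> carrier_mat 2 (2 * N)"
  by (simp add: F_matrix_def)

lemma index_mult_mat_adjoint:
  fixes A :: "complex Matrix.mat"
  assumes "A \<in> carrier_mat m n" "i < m" "l < m"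
  shows "(A * mat_adjoint A) $$ (i, l) = (\<Sum>k\<in>{0..<n}. A $$ (i, k) * cnj (A $$ (l, k)))"
proof -
  have dim: "dim_row A = m" "dim_col A = n"
    using assms by auto
  \<comment> \<open>Hence the entries of the product are Hermitian inner products of the rows of
    \<open>A\<close>.\<close>
  have "col (mat_adjoint A) l $ k = cnj (A $$ (l, k))" if "k < n" for k
    using that assms dim by (simp add: mat_adjoint_def mat_of_rows_def)
  then show ?thesis
    using assms dim by (simp add: scalar_prod_def mat_adjoint_def)
qed

lemma M_matrix_carrier: "M_matrix N F G z \<in> carrier_mat 2 2"
  using F_matrix_carrier[of N F G z]
  by (intro carrier_matI) (simp_all add: M_matrix_def mat_adjoint_def)

text \<open>The sign of the entries \<open>- G j z\<close> cancels on the diagonal and survives off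
  it, which produces the differences there.\<close>

lemma M_matrix_index:
  shows "M_matrix N F G z $$ (0, 0) =
      (\<Sum>j\<in>{1..N}. F j z * cnj (F j z)) + (\<Sum>j\<in>{1..N}. G j z * cnj (G j z))"
    and "M_matrix N F G z $$ (0, 1) =
      (\<Sum>j\<in>{1..N}. F j z * cnj (hat (G j) z)) - (\<Sum>j\<in>{1..N}. G j z * cnj (hat (F j) z))"
    and "M_matrix N F G z $$ (1, 0) =
      (\<Sum>j\<in>{1..N}. hat (G j) z * cnj (F j z)) - (\<Sum>j\<in>{1..N}. hat (F j) z * cnj (G j z))"
    and "M_matrix N F G z $$ (1, 1) =
      (\<Sum>j\<in>{1..N}. hat (G j) z * cnj (hat (G j) z)) + (\<Sum>j\<in>{1..N}. hat (F j) z * cnj (hat (F j) z))"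
proof -
  have lt: "(0::nat) < 2" "(1::nat) < 2"
    by simp_all
  have entry: "M_matrix N F G z $$ (i, l) = (\<Sum>j\<in>{1..N}.
      F_matrix N F G z $$ (i, 2 * (j - 1)) * cnj (F_matrix N F G z $$ (l, 2 * (j - 1))) +
      F_matrix N F G z $$ (i, 2 * (j - 1) + 1) * cnj (F_matrix N F G z $$ (l, 2 * (j - 1) + 1)))"
    if "i < 2" "l < 2" for i l
    unfolding M_matrix_def index_mult_mat_adjoint[OF F_matrix_carrier that] sum_consecutive_pairs ..
  show "M_matrix N F G z $$ (0, 0) =
      (\<Sum>j\<in>{1..N}. F j z * cnj (F j z)) + (\<Sum>j\<in>{1..N}. G j z * cnj (G j z))"
    unfolding entry[OF lt(1) lt(1)] sum.distrib[symmetric]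
    by (rule sum.cong[OF refl]) (simp only: F_matrix_index, simp)
  show "M_matrix N F G z $$ (0, 1) =
      (\<Sum>j\<in>{1..N}. F j z * cnj (hat (G j) z)) - (\<Sum>j\<in>{1..N}. G j z * cnj (hat (F j) z))"
    unfolding entry[OF lt(1) lt(2)] sum_subtractf[symmetric]
    by (rule sum.cong[OF refl]) (simp only: F_matrix_index, simp)
  show "M_matrix N F G z $$ (1, 0) =
      (\<Sum>j\<in>{1..N}. hat (G j) z * cnj (F j z)) - (\<Sum>j\<in>{1..N}. hat (F j) z * cnj (G j z))"
    unfolding entry[OF lt(2) lt(1)] sum_subtractf[symmetric]
    by (rule sum.cong[OF refl]) (simp only: F_matrix_index, simp)
  show "M_matrix N F G z $$ (1, 1) =
      (\<Sum>j\<in>{1..N}. hat (G j) z * cnj (hat (G j) z)) + (\<Sum>j\<in>{1..N}. hat (F j) z * cnj (hat (F j) z))"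
    unfolding entry[OF lt(2) lt(2)] sum.distrib[symmetric]
    by (rule sum.cong[OF refl]) (simp only: F_matrix_index)
qed

theorem theorem7p1:
  fixes N :: nat and F G :: "nat \<Rightarrow> complex \<Rightarrow> complex" and z :: complex
  assumes "N \<ge> 1"
    and "\<And>j. j \<in> {1..N} \<Longrightarrow> F j holomorphic_on ball 0 1"
    and "\<And>j. j \<in> {1..N} \<Longrightarrow> G j holomorphic_on ball 0 1"
    and "z \<in> ball 0 1"
  shows "Determinant.det (M_matrix N F G z) = complex_of_real (
      (\<Sum>r\<in>{1..N}. \<Sum>j\<in>{1..N}. (cmod (F j z * hat (F r) z + G r z * hat (G j) z))\<^sup>2)
    + (\<Sum>(r, j)\<in>{(r, j). 1 \<le> r \<and> r < j \<and> j \<le> N}. (cmod (F j z * hat (G r) z - F r z * hat (G j) z))\<^sup>2)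
    + (\<Sum>(r, j)\<in>{(r, j). 1 \<le> r \<and> r < j \<and> j \<le> N}. (cmod (G j z * hat (F r) z - G r z * hat (F j) z))\<^sup>2))"
  \<comment> \<open>After the rewriting only a polynomial identity remains, in four squared norms,
    two inner products and the conjugates of the latter.\<close>
  unfolding det_mat_2[OF M_matrix_carrier] M_matrix_index of_real_add
    \<comment> \<open>The arguments instantiate \<open>a\<close>, \<open>d\<close>,
      \<open>b\<close>, \<open>c\<close>, in order of first occurrence in the lemma.\<close>
    sum_cross_pairs_cmod[of "\<lambda>j. F j z" "\<lambda>j. hat (F j) z" "\<lambda>j. G j z" "\<lambda>j. hat (G j) z"]
    Lagrange_identity_cmod[of "\<lambda>j. F j z" "\<lambda>j. hat (G j) z"]
    Lagrange_identity_cmod[of "\<lambda>j. G j z" "\<lambda>j. hat (F j) z"]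
  by (simp only: algebra_simps)

end
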